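(* Let $(G,\circ)$ be an F-Lie group, let $(\mathfrak X^+(G),[\cdot,\cdot],\circ)$ be the associated algebra of left-invariant vector fields with Lie bracket and product $\circ$, and let $\nabla$ be the left-invariant affine connection on $G$ determined by $$\nabla_{u^+}v^+=\tfrac12[u^+,v^+]+u^+\circ v^+\qquad (u^+,v^+\in\mathfrak X^+(G)).$$ Then the curvature tensor $R$ of $\nabla$ satisfies, for all left-invariant vector fields $u^+,v^+,w^+\in\mathfrak X^+(G)$, $$R(u^+,v^+)w^+=-\tfrac14[[u^+,v^+],w^+]+\tfrac12\bigl(L(u^+,v^+,w^+)-L(v^+,u^+,w^+)\bigr).$$
   Context: An F-manifold is a smooth manifold $M$ with a $C^\infty(M)$-bilinear, associative and commutative product $\circ$ on $\mathfrak X(M)$ such that the Leibnizator $$L(X,Y,Z):=[X,Y\circ Z]-[X,Y]\circ Z-Y\circ[X,Z]$$ satisfies the Hertling-Manin condition $L(X\circ Y,Z,W)=L(X,Z,W)\circ Y+X\circ L(Y,Z,W)$ for all vector fields $X,Y,Z,W$ (no unit for $\circ$ is required). An F-Lie group $(G,\circ)$ is an F-manifold whose underlying manifold $G$ is a simply connected Lie group and whose product $\circ$ is left-invariant, i.e. the product of two left-invariant vector fields is left-invariant. $\mathfrak X^+(G)$ is the space of left-invariant vector fields, canonically isomorphic to $\mathfrak g=T_eG$; $u^+$ denotes the left-invariant field with value $u\in\mathfrak g$ at the identity $e$. The curvature convention is $R(X,Y)Z=\nabla_X\nabla_YZ-\nabla_Y\nabla_XZ-\nabla_{[X,Y]}Z$.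 *)

theory Defs
  imports "HOL-Analysis.Analysis" "HOL-Algebra.Group" "HOL-Library.Function_Algebras"
begin

section \<open>Smooth maps between open subsets of finite-dimensional spaces\<close>

text \<open>
  \<open>f\<close> is of class \<open>C^k\<close> on the open set \<open>S\<close>: all iterated directional derivatives of order at
  most \<open>k\<close> exist as evaluations of Frechet derivatives and are continuous.
\<close>

fun Ck_on :: "nat \<Rightarrow> 'a::real_normed_vector set \<Rightarrow> ('a \<Rightarrow> 'b::real_normed_vector) \<Rightarrow> bool" where
  "Ck_on 0 S f \<longleftrightarrow> continuous_on S f"
| "Ck_on (Suc k) S f \<longleftrightarrow>
     (\<forall>x\<in>S. f differentiable (at x)) \<and> (\<forall>v. Ck_on k S (\<lambda>x. frechet_derivative f (at x) v))"

definition smooth_on :: "'a::real_normed_vector set \<Rightarrow> ('a \<Rightarrow> 'b::real_normed_vector) \<Rightarrow> bool" where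
  "smooth_on S f \<longleftrightarrow> (\<forall>k. Ck_on k S f)"


section \<open>Smooth manifolds\<close>

text \<open>
  A manifold is a subset \<open>M\<close> of a second countable Hausdorff type, carrying the subspace topology.
  Charts take values in a finite-dimensional real normed space \<open>'e\<close>; the class
  \<open>euclidean_space\<close> is not used for \<open>'e\<close> because it excludes dimension zero. An atlas need not be
  maximal.
\<close>

type_synonym ('g, 'e) chart = "'g set \<times> ('g \<Rightarrow> 'e)"

definition is_chart :: "'g::topological_space set \<Rightarrow> ('g, 'e::real_normed_vector) chart \<Rightarrow> bool" where
  "is_chart M c \<longleftrightarrow> (case c of (U, \<phi>) \<Rightarrow>
     openin (top_of_set M) U \<and> open (\<phi> ` U) \<and> homeomorphism U (\<phi> ` U) \<phi> (inv_into U \<phi>))"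

definition smoothly_compatible ::
  "('g, 'e::real_normed_vector) chart \<Rightarrow> ('g, 'e) chart \<Rightarrow> bool" where
  "smoothly_compatible c d \<longleftrightarrow> (case (c, d) of ((U, \<phi>), (V, \<psi>)) \<Rightarrow>
     smooth_on (\<phi> ` (U \<inter> V)) (\<psi> \<circ> inv_into U \<phi>))"

locale smooth_manifold =
  fixes M :: "'g::{t2_space, second_countable_topology} set"
    and \<A> :: "('g, 'e::real_normed_vector) chart set"
  assumes finite_dimensional: "\<exists>B :: 'e set. finite B \<and> span B = UNIV"
    and charts: "\<And>c. c \<in> \<A> \<Longrightarrow> is_chart M c"
    and cover: "(\<Union>c\<in>\<A>. fst c) = M"
    and compatible: "\<And>c d. c \<in> \<A> \<Longrightarrow> d \<in> \<A> \<Longrightarrow> smoothly_compatible c d"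

definition prod_atlas :: "('g, 'e) chart set \<Rightarrow> ('h, 'f) chart set \<Rightarrow> ('g \<times> 'h, 'e \<times> 'f) chart set"
  where "prod_atlas \<A> \<B> = {(U \<times> V, map_prod \<phi> \<psi>) | U \<phi> V \<psi>. (U, \<phi>) \<in> \<A> \<and> (V, \<psi>) \<in> \<B>}"

definition smooth_map ::
  "'g::topological_space set \<Rightarrow> ('g, 'e::real_normed_vector) chart set \<Rightarrow>
   'h::topological_space set \<Rightarrow> ('h, 'f::real_normed_vector) chart set \<Rightarrow> ('g \<Rightarrow> 'h) \<Rightarrow> bool" where
  "smooth_map M \<A> N \<B> F \<longleftrightarrow>
     F \<in> M \<rightarrow> N \<and> continuous_on M F \<and>
     (\<forall>(U, \<phi>)\<in>\<A>. \<forall>(V, \<psi>)\<in>\<B>. smooth_on (\<phi> ` (U \<inter> F -` V)) (\<psi> \<circ> F \<circ> inv_into U \<phi>))"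

text \<open>
  Objects that live on \<open>M\<close> are total functions on the type \<open>'g\<close>, so they are extended by zero:
  smooth functions vanish off \<open>M\<close>, tangent vectors vanish on functions that are not in
  \<open>C_infty M \<A>\<close>, and vector fields vanish off \<open>M\<close>. With this convention, HOL equality is
  equality of functions, tangent vectors and vector fields on \<open>M\<close>.
\<close>

definition C_infty :: "'g set \<Rightarrow> ('g, 'e::real_normed_vector) chart set \<Rightarrow> ('g \<Rightarrow> real) set" where
  "C_infty M \<A> = {f. (\<forall>(U, \<phi>)\<in>\<A>. smooth_on (\<phi> ` U) (f \<circ> inv_into U \<phi>)) \<and> (\<forall>x. x \<notin> M \<longrightarrow> f x = 0)}"

text \<open>Tangent vectors at \<open>p\<close> are the derivations of \<open>C_infty M \<A>\<close> at \<open>p\<close>.\<close>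

type_synonym 'g tvector = "('g \<Rightarrow> real) \<Rightarrow> real"

definition tangent_space ::
  "'g set \<Rightarrow> ('g, 'e::real_normed_vector) chart set \<Rightarrow> 'g \<Rightarrow> 'g tvector set" where
  "tangent_space M \<A> p = {v.
     (\<forall>f\<in>C_infty M \<A>. \<forall>g\<in>C_infty M \<A>. v (f + g) = v f + v g) \<and>
     (\<forall>c. \<forall>f\<in>C_infty M \<A>. v (\<lambda>x. c * f x) = c * v f) \<and>
     (\<forall>f\<in>C_infty M \<A>. \<forall>g\<in>C_infty M \<A>. v (f * g) = f p * v g + g p * v f) \<and>
     (\<forall>f. f \<notin> C_infty M \<A> \<longrightarrow> v f = 0)}"

definition differential ::
  "'g set \<Rightarrow> 'h set \<Rightarrow> ('h, 'f::real_normed_vector) chart set \<Rightarrow> ('g \<Rightarrow> 'h) \<Rightarrow> 'g tvector \<Rightarrow> 'h tvector"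
  where "differential M N \<B> F v =
    (\<lambda>f. if f \<in> C_infty N \<B> then v (\<lambda>x. if x \<in> M then f (F x) else 0) else 0)"

type_synonym 'g vfield = "'g \<Rightarrow> 'g tvector"

definition vector_fields ::
  "'g set \<Rightarrow> ('g, 'e::real_normed_vector) chart set \<Rightarrow> 'g vfield set" where
  "vector_fields M \<A> = {X.
     (\<forall>p\<in>M. X p \<in> tangent_space M \<A> p) \<and>
     (\<forall>p. p \<notin> M \<longrightarrow> X p = 0) \<and>
     (\<forall>f\<in>C_infty M \<A>. (\<lambda>p. X p f) \<in> C_infty M \<A>)}"

text \<open>Addition and subtraction of vector fields are the pointwise ones on function types.\<close>

definition vf_fscale :: "('g \<Rightarrow> real) \<Rightarrow> 'g vfield \<Rightarrow> 'g vfield" (infixr "\<cdot>\<^sub>F" 75) where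
  "h \<cdot>\<^sub>F X = (\<lambda>p f. h p * X p f)"

definition vf_scale :: "real \<Rightarrow> 'g vfield \<Rightarrow> 'g vfield" (infixr "\<cdot>\<^sub>R" 75) where
  "c \<cdot>\<^sub>R X = (\<lambda>p f. c * X p f)"

definition vf_bracket :: "'g vfield \<Rightarrow> 'g vfield \<Rightarrow> 'g vfield" where
  "vf_bracket X Y = (\<lambda>p f. X p (\<lambda>q. Y q f) - Y p (\<lambda>q. X q f))"


section \<open>F-manifolds\<close>

definition leibnizator ::
  "('g vfield \<Rightarrow> 'g vfield \<Rightarrow> 'g vfield) \<Rightarrow> 'g vfield \<Rightarrow> 'g vfield \<Rightarrow> 'g vfield \<Rightarrow> 'g vfield" where
  "leibnizator prd X Y Z =
     vf_bracket X (prd Y Z) - prd (vf_bracket X Y) Z - prd Y (vf_bracket X Z)"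

locale F_manifold = smooth_manifold M \<A>
  for M :: "'g::{t2_space, second_countable_topology} set"
    and \<A> :: "('g, 'e::real_normed_vector) chart set" +
  fixes prd :: "'g vfield \<Rightarrow> 'g vfield \<Rightarrow> 'g vfield" (infixl "\<circ>\<^sub>F" 70)
  assumes prd_closed: "\<lbrakk>X \<in> vector_fields M \<A>; Y \<in> vector_fields M \<A>\<rbrakk> \<Longrightarrow>
      X \<circ>\<^sub>F Y \<in> vector_fields M \<A>"
    and prd_add_left: "\<lbrakk>X \<in> vector_fields M \<A>; Y \<in> vector_fields M \<A>; Z \<in> vector_fields M \<A>\<rbrakk> \<Longrightarrow>
      (X + Y) \<circ>\<^sub>F Z = X \<circ>\<^sub>F Z + Y \<circ>\<^sub>F Z"
    and prd_add_right: "\<lbrakk>X \<in> vector_fields M \<A>; Y \<in> vector_fields M \<A>; Z \<in> vector_fields M \<A>\<rbrakk> \<Longrightarrow>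
      X \<circ>\<^sub>F (Y + Z) = X \<circ>\<^sub>F Y + X \<circ>\<^sub>F Z"
    and prd_scale_left: "\<lbrakk>h \<in> C_infty M \<A>; X \<in> vector_fields M \<A>; Y \<in> vector_fields M \<A>\<rbrakk> \<Longrightarrow>
      (h \<cdot>\<^sub>F X) \<circ>\<^sub>F Y = h \<cdot>\<^sub>F (X \<circ>\<^sub>F Y)"
    and prd_scale_right: "\<lbrakk>h \<in> C_infty M \<A>; X \<in> vector_fields M \<A>; Y \<in> vector_fields M \<A>\<rbrakk> \<Longrightarrow>
      X \<circ>\<^sub>F (h \<cdot>\<^sub>F Y) = h \<cdot>\<^sub>F (X \<circ>\<^sub>F Y)"
    and prd_assoc: "\<lbrakk>X \<in> vector_fields M \<A>; Y \<in> vector_fields M \<A>; Z \<in> vector_fields M \<A>\<rbrakk> \<Longrightarrow>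
      (X \<circ>\<^sub>F Y) \<circ>\<^sub>F Z = X \<circ>\<^sub>F (Y \<circ>\<^sub>F Z)"
    and prd_comm: "\<lbrakk>X \<in> vector_fields M \<A>; Y \<in> vector_fields M \<A>\<rbrakk> \<Longrightarrow> X \<circ>\<^sub>F Y = Y \<circ>\<^sub>F X"
    and hertling_manin: "\<lbrakk>X \<in> vector_fields M \<A>; Y \<in> vector_fields M \<A>; Z \<in> vector_fields M \<A>;
      W \<in> vector_fields M \<A>\<rbrakk> \<Longrightarrow>
      leibnizator prd (X \<circ>\<^sub>F Y) Z W = leibnizator prd X Z W \<circ>\<^sub>F Y + X \<circ>\<^sub>F leibnizator prd Y Z W"


section \<open>F-Lie groups\<close>

locale lie_group = group G + smooth_manifold "carrier G" \<A>
  for G :: "('g::{t2_space, second_countable_topology}, 'm) monoid_scheme" (structure)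
    and \<A> :: "('g, 'e::real_normed_vector) chart set" +
  assumes smooth_mult: "smooth_map (carrier G \<times> carrier G) (prod_atlas \<A> \<A>) (carrier G) \<A>
      (\<lambda>(x, y). x \<otimes> y)"
    and smooth_inv: "smooth_map (carrier G) \<A> (carrier G) \<A> (m_inv G)"

definition left_invariant_fields ::
  "('g, 'm) monoid_scheme \<Rightarrow> ('g, 'e::real_normed_vector) chart set \<Rightarrow> 'g vfield set" where
  "left_invariant_fields G \<A> = {X \<in> vector_fields (carrier G) \<A>.
     \<forall>a\<in>carrier G. \<forall>x\<in>carrier G.
       X (a \<otimes>\<^bsub>G\<^esub> x) = differential (carrier G) (carrier G) \<A> (\<lambda>y. a \<otimes>\<^bsub>G\<^esub> y) (X x)}"

locale F_lie_group = lie_group G \<A> + F_manifold "carrier G" \<A> prd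
  for G :: "('g::{t2_space, second_countable_topology}, 'm) monoid_scheme" (structure)
    and \<A> :: "('g, 'e::real_normed_vector) chart set"
    and prd :: "'g vfield \<Rightarrow> 'g vfield \<Rightarrow> 'g vfield" +
  assumes simply_connected: "simply_connected (carrier G)"
    and prd_left_invariant:
      "\<lbrakk>X \<in> left_invariant_fields G \<A>; Y \<in> left_invariant_fields G \<A>\<rbrakk> \<Longrightarrow>
        prd X Y \<in> left_invariant_fields G \<A>"


section \<open>Affine connections\<close>

locale affine_connection = smooth_manifold M \<A>
  for M :: "'g::{t2_space, second_countable_topology} set"
    and \<A> :: "('g, 'e::real_normed_vector) chart set" +
  fixes nabla :: "'g vfield \<Rightarrow> 'g vfield \<Rightarrow> 'g vfield"
  assumes nabla_closed: "\<lbrakk>X \<in> vector_fields M \<A>; Y \<in> vector_fields M \<A>\<rbrakk> \<Longrightarrow>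
      nabla X Y \<in> vector_fields M \<A>"
    and nabla_add_left: "\<lbrakk>X \<in> vector_fields M \<A>; Y \<in> vector_fields M \<A>; Z \<in> vector_fields M \<A>\<rbrakk> \<Longrightarrow>
      nabla (X + Y) Z = nabla X Z + nabla Y Z"
    and nabla_scale_left: "\<lbrakk>h \<in> C_infty M \<A>; X \<in> vector_fields M \<A>; Y \<in> vector_fields M \<A>\<rbrakk> \<Longrightarrow>
      nabla (h \<cdot>\<^sub>F X) Y = h \<cdot>\<^sub>F nabla X Y"
    and nabla_add_right: "\<lbrakk>X \<in> vector_fields M \<A>; Y \<in> vector_fields M \<A>; Z \<in> vector_fields M \<A>\<rbrakk> \<Longrightarrow>
      nabla X (Y + Z) = nabla X Y + nabla X Z"
    and nabla_leibniz: "\<lbrakk>h \<in> C_infty M \<A>; X \<in> vector_fields M \<A>; Y \<in> vector_fields M \<A>\<rbrakk> \<Longrightarrow>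
      nabla X (h \<cdot>\<^sub>F Y) = (\<lambda>p. X p h) \<cdot>\<^sub>F Y + h \<cdot>\<^sub>F nabla X Y"

definition curvature ::
  "('g vfield \<Rightarrow> 'g vfield \<Rightarrow> 'g vfield) \<Rightarrow> 'g vfield \<Rightarrow> 'g vfield \<Rightarrow> 'g vfield \<Rightarrow> 'g vfield" where
  "curvature nabla X Y Z =
     nabla X (nabla Y Z) - nabla Y (nabla X Z) - nabla (vf_bracket X Y) Z"

text \<open>The push-forward of a vector field along the left translation by \<open>a\<close>.\<close>

definition left_translate ::
  "('g, 'm) monoid_scheme \<Rightarrow> ('g, 'e::real_normed_vector) chart set \<Rightarrow> 'g \<Rightarrow> 'g vfield \<Rightarrow> 'g vfield"
  where "left_translate G \<A> a X = (\<lambda>p. if p \<in> carrier G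
    then differential (carrier G) (carrier G) \<A> (\<lambda>y. a \<otimes>\<^bsub>G\<^esub> y) (X (inv\<^bsub>G\<^esub> a \<otimes>\<^bsub>G\<^esub> p)) else 0)"

text \<open>A connection is left-invariant if all left translations are affine transformations.\<close>

locale left_invariant_connection = lie_group G \<A> + affine_connection "carrier G" \<A> nabla
  for G :: "('g::{t2_space, second_countable_topology}, 'm) monoid_scheme" (structure)
    and \<A> :: "('g, 'e::real_normed_vector) chart set"
    and nabla :: "'g vfield \<Rightarrow> 'g vfield \<Rightarrow> 'g vfield" +
  assumes nabla_left_translate:
    "\<lbrakk>a \<in> carrier G; X \<in> vector_fields (carrier G) \<A>; Y \<in> vector_fields (carrier G) \<A>\<rbrakk> \<Longrightarrow>
      nabla (left_translate G \<A> a X) (left_translate G \<A> a Y) = left_translate G \<A> a (nabla X Y)"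

end

theory Submission imports Defs begin

text \<open>
  Left-invariant fields are closed under the bracket and the product, so on them the curvature
  expands by the defining formula alone. The terms quadratic in the product cancel because it is
  commutative and associative, the iterated brackets combine by the Jacobi identity, and the mixed
  terms form the two Leibnizators.
\<close>

section \<open>Functions of class \<open>C^k\<close>\<close>

text \<open>Openness of \<open>S\<close> makes the agreement hold near each point, so the Frechet
  derivatives agree on \<open>S\<close> and the induction passes to them.\<close>

lemma Ck_on_cong:
  assumes "open S" "\<And>x. x \<in> S \<Longrightarrow> f x = g x" "Ck_on k S f"
  shows "Ck_on k S g"
  using assms(2,3)
proof (induction k arbitrary: f g)
  case 0
  then show ?case
    using continuous_on_cong[of S S f g] by simp
next
  case (Suc k)
  have der: "(g has_derivative frechet_derivative f (at x)) (at x)" if "x \<in> S" for x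
    using Suc.prems that assms(1)
    by (metis Ck_on.simps(2) frechet_derivative_works has_derivative_transform_within_open)
  then have eq: "frechet_derivative f (at x) v = frechet_derivative g (at x) v" if "x \<in> S" for x v
    using that frechet_derivative_at by metis
  have "Ck_on k S (\<lambda>x. frechet_derivative g (at x) v)" for v
    using Suc.IH[OF eq] Suc.prems(2) by simp
  then show ?case
    using der by (auto simp: differentiable_def)
qed

lemma Ck_on_SucD: "Ck_on (Suc k) S f \<Longrightarrow> Ck_on k S f"
proof (induction k arbitrary: f)
  case 0
  then show ?case
    by (simp add: differentiable_imp_continuous_on differentiable_at_imp_differentiable_on)
next
  case (Suc k)
  then show ?case
    by (metis Ck_on.simps(2))
qed

text \<open>Uniqueness of the Frechet derivative allows an explicit formula \<open>f'\<close> in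
  place of \<open>frechet_derivative\<close>; the closure rules below supply the sum and product
  rules this way.\<close>

lemma Ck_on_SucI:
  assumes "open S" "\<And>x. x \<in> S \<Longrightarrow> (f has_derivative f' x) (at x)" "\<And>v. Ck_on k S (\<lambda>x. f' x v)"
  shows "Ck_on (Suc k) S f"
proof -
  have "f' x v = frechet_derivative f (at x) v" if "x \<in> S" for x v
    using assms(2)[OF that] frechet_derivative_at by metis
  then have "Ck_on k S (\<lambda>x. frechet_derivative f (at x) v)" for v
    using Ck_on_cong[OF assms(1) _ assms(3)] by simp
  then show ?thesis
    using assms(2) by (auto simp: differentiable_def)
qed

lemma Ck_on_has_derivative:
  assumes "Ck_on (Suc k) S f" "x \<in> S"
  shows "(f has_derivative frechet_derivative f (at x)) (at x)"
  using assms by (simp add: frechet_derivative_works)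

lemma Ck_on_const: "open S \<Longrightarrow> Ck_on k S (\<lambda>x. c)"
\<comment> \<open>The derivative is the constant 0, so the induction hypothesis is needed for
  another constant.\<close>
proof (induction k arbitrary: c)
  case (Suc k)
  then show ?case
    by (intro Ck_on_SucI[where f' = "\<lambda>x v. 0"]) (auto intro: derivative_eq_intros)
qed auto

lemma Ck_on_add:
  "open S \<Longrightarrow> Ck_on k S f \<Longrightarrow> Ck_on k S g \<Longrightarrow> Ck_on k S (\<lambda>x. f x + g x)"
proof (induction k arbitrary: f g)
  case (Suc k)
  then show ?case
    by (intro Ck_on_SucI[where f' = "\<lambda>x v. frechet_derivative f (at x) v + frechet_derivative g (at x) v"])
      (auto intro!: has_derivative_add Ck_on_has_derivative)
qed (simp add: continuous_on_add)

lemma Ck_on_mult: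
  fixes f g :: "'a::real_normed_vector \<Rightarrow> 'b::real_normed_algebra"
  shows "open S \<Longrightarrow> Ck_on k S f \<Longrightarrow> Ck_on k S g \<Longrightarrow> Ck_on k S (\<lambda>x. f x * g x)"
proof (induction k arbitrary: f g)
  case (Suc k)
  \<comment> \<open>The product rule keeps one factor undifferentiated, so \<open>f\<close> and
    \<open>g\<close> themselves are needed at level \<open>k\<close>.\<close>
  have "Ck_on k S f" "Ck_on k S g"
    using Suc.prems Ck_on_SucD by blast+
  then show ?case
    using Suc
    by (intro Ck_on_SucI[where f' = "\<lambda>x v. f x * frechet_derivative g (at x) v
        + frechet_derivative f (at x) v * g x"])
      (auto intro!: has_derivative_mult Ck_on_has_derivative Ck_on_add)
qed (simp add: continuous_on_mult)


section \<open>Lie algebra of vector fields\<close>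

context smooth_manifold
begin

text \<open>The constant is cut off outside \<open>M\<close> to fit the convention for
  \<open>C_infty\<close>. It lets real scalars act as smooth functions.\<close>

lemma C_infty_const: "(\<lambda>x. if x \<in> M then c else 0) \<in> C_infty M \<A>"
proof -
  have "smooth_on (\<phi> ` U) ((\<lambda>x. if x \<in> M then c else 0) \<circ> inv_into U \<phi>)"
    if "(U, \<phi>) \<in> \<A>" for U \<phi>
  proof -
    have op: "open (\<phi> ` U)"
      using charts[OF that] by (auto simp: is_chart_def)
    have "U \<subseteq> M"
      using cover that by force
    then have "c = ((\<lambda>x. if x \<in> M then c else 0) \<circ> inv_into U \<phi>) y" if "y \<in> \<phi> ` U" for y
      using inv_into_into[OF that] by auto
    then show ?thesis
      unfolding smooth_on_def using Ck_on_cong[OF op _ Ck_on_const[OF op]] by blast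
  qed
  then show ?thesis
    by (auto simp: C_infty_def)
qed

lemma C_infty_zero: "(\<lambda>x. 0) \<in> C_infty M \<A>"
  using C_infty_const[of 0] by simp

lemma C_infty_add:
  assumes "f \<in> C_infty M \<A>" "g \<in> C_infty M \<A>"
  shows "(\<lambda>x. f x + g x) \<in> C_infty M \<A>"
  using assms charts unfolding C_infty_def smooth_on_def is_chart_def
  by (fastforce simp: comp_def intro: Ck_on_add)

lemma C_infty_mult:
  assumes "f \<in> C_infty M \<A>" "g \<in> C_infty M \<A>"
  shows "(\<lambda>x. f x * g x) \<in> C_infty M \<A>"
  using assms charts unfolding C_infty_def smooth_on_def is_chart_def
  by (fastforce simp: comp_def intro: Ck_on_mult)

lemma C_infty_scale:
  assumes "f \<in> C_infty M \<A>"
  shows "(\<lambda>x. c * f x) \<in> C_infty M \<A>"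
proof -
  have "(\<lambda>x. c * f x) = (\<lambda>x. (if x \<in> M then c else 0) * f x)"
    using assms by (auto simp: C_infty_def)
  then show ?thesis
    using C_infty_mult[OF C_infty_const assms] by simp
qed

lemma C_infty_diff:
  assumes "f \<in> C_infty M \<A>" "g \<in> C_infty M \<A>"
  shows "(\<lambda>x. f x - g x) \<in> C_infty M \<A>"
  using C_infty_add[OF assms(1) C_infty_scale[OF assms(2), of "-1"]] by simp

section \<open>Vector fields as derivations\<close>

lemma vf_app_C_infty:
  "X \<in> vector_fields M \<A> \<Longrightarrow> f \<in> C_infty M \<A> \<Longrightarrow> (\<lambda>p. X p f) \<in> C_infty M \<A>"
  by (simp add: vector_fields_def)

lemma vf_outside: "X \<in> vector_fields M \<A> \<Longrightarrow> p \<notin> M \<Longrightarrow> X p f = 0"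
  by (simp add: vector_fields_def)

lemma vf_not_C_infty: "X \<in> vector_fields M \<A> \<Longrightarrow> f \<notin> C_infty M \<A> \<Longrightarrow> X p f = 0"
  using vf_outside[of X p f] by (auto simp: vector_fields_def tangent_space_def)

text \<open>Off \<open>M\<close> both sides are 0. Like the other derivation rules below, this
  therefore holds at every point and rewrites without a membership condition on
  \<open>p\<close>.\<close>

lemma vf_add:
  assumes "X \<in> vector_fields M \<A>" "f \<in> C_infty M \<A>" "g \<in> C_infty M \<A>"
  shows "X p (\<lambda>x. f x + g x) = X p f + X p g"
  using assms vf_outside[OF assms(1), of p]
  by (cases "p \<in> M") (auto simp: vector_fields_def tangent_space_def plus_fun_def)

lemma vf_scale:
  assumes "X \<in> vector_fields M \<A>" "f \<in> C_infty M \<A>"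
  shows "X p (\<lambda>x. c * f x) = c * X p f"
  using assms vf_outside[OF assms(1), of p]
  by (cases "p \<in> M") (auto simp: vector_fields_def tangent_space_def)

lemma vf_mult:
  assumes "X \<in> vector_fields M \<A>" "f \<in> C_infty M \<A>" "g \<in> C_infty M \<A>"
  shows "X p (\<lambda>x. f x * g x) = f p * X p g + g p * X p f"
  using assms vf_outside[OF assms(1), of p]
  by (cases "p \<in> M") (auto simp: vector_fields_def tangent_space_def times_fun_def)

lemma vf_zero: "X \<in> vector_fields M \<A> \<Longrightarrow> X p (\<lambda>x. 0) = 0"
  using vf_scale[OF _ C_infty_zero, of X p 0] by simp

lemma vf_diff:
  assumes "X \<in> vector_fields M \<A>" "f \<in> C_infty M \<A>" "g \<in> C_infty M \<A>"
  shows "X p (\<lambda>x. f x - g x) = X p f - X p g"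
  using vf_add[OF assms(1,2) C_infty_scale[OF assms(3), of "-1"], of p]
    vf_scale[OF assms(1,3), of p "-1"] by simp

lemma vector_fieldsI:
  assumes "\<And>p f g. f \<in> C_infty M \<A> \<Longrightarrow> g \<in> C_infty M \<A> \<Longrightarrow> X p (\<lambda>x. f x + g x) = X p f + X p g"
    and "\<And>p c f. f \<in> C_infty M \<A> \<Longrightarrow> X p (\<lambda>x. c * f x) = c * X p f"
    and "\<And>p f g. f \<in> C_infty M \<A> \<Longrightarrow> g \<in> C_infty M \<A> \<Longrightarrow>
      X p (\<lambda>x. f x * g x) = f p * X p g + g p * X p f"
    and "\<And>p f. f \<notin> C_infty M \<A> \<Longrightarrow> X p f = 0"
    and "\<And>p f. p \<notin> M \<Longrightarrow> X p f = 0"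
    and "\<And>f. f \<in> C_infty M \<A> \<Longrightarrow> (\<lambda>p. X p f) \<in> C_infty M \<A>"
  shows "X \<in> vector_fields M \<A>"
  using assms
  by (auto simp: vector_fields_def tangent_space_def plus_fun_def times_fun_def fun_eq_iff)

lemma vector_fields_add:
  assumes "X \<in> vector_fields M \<A>" "Y \<in> vector_fields M \<A>"
  shows "X + Y \<in> vector_fields M \<A>"
  using assms
  by (intro vector_fieldsI)
    (simp_all add: vf_add vf_scale vf_mult vf_not_C_infty vf_outside vf_app_C_infty C_infty_add
      algebra_simps)

lemma vector_fields_scale:
  assumes "X \<in> vector_fields M \<A>"
  shows "c \<cdot>\<^sub>R X \<in> vector_fields M \<A>"
  using assms
  by (intro vector_fieldsI)
    (simp_all add: vf_scale_def vf_add vf_scale vf_mult vf_not_C_infty vf_outside vf_app_C_infty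
      C_infty_scale algebra_simps)

text \<open>The one nontrivial point is the Leibniz rule: expanding \<open>X\<close> applied to
  \<open>Y (f g)\<close> leaves the cross terms \<open>(X f)(Y g) + (X g)(Y f)\<close>, symmetric in
  \<open>X\<close> and \<open>Y\<close>, so they cancel in the commutator.\<close>

lemma vector_fields_bracket:
  assumes "X \<in> vector_fields M \<A>" "Y \<in> vector_fields M \<A>"
  shows "vf_bracket X Y \<in> vector_fields M \<A>"
  using assms
  by (intro vector_fieldsI)
    (simp_all add: vf_bracket_def assms[THEN vf_add] assms[THEN vf_scale] assms[THEN vf_mult]
      vf_not_C_infty vf_outside vf_zero assms[THEN vf_app_C_infty] C_infty_diff C_infty_add C_infty_mult C_infty_scale algebra_simps)

lemma vf_bracket_antisym: "vf_bracket Y X = - vf_bracket X Y"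
  by (simp add: vf_bracket_def fun_eq_iff)

lemma vf_bracket_add_right:
  assumes "X \<in> vector_fields M \<A>" "Y \<in> vector_fields M \<A>" "Z \<in> vector_fields M \<A>"
  shows "vf_bracket X (Y + Z) = vf_bracket X Y + vf_bracket X Z"
proof (intro ext)
  fix p f
  show "vf_bracket X (Y + Z) p f = (vf_bracket X Y + vf_bracket X Z) p f"
    using assms
    \<comment> \<open>Linearity of \<open>X\<close> is available on smooth functions only; for other
      \<open>f\<close> the inner fields give the zero function, which \<open>X\<close> sends to
      0.\<close>
    by (cases "f \<in> C_infty M \<A>")
      (simp_all add: vf_bracket_def vf_add[OF assms(1)] vf_not_C_infty vf_zero vf_app_C_infty)
qed

lemma vf_bracket_scale_right:
  assumes "X \<in> vector_fields M \<A>" "Y \<in> vector_fields M \<A>"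
  shows "vf_bracket X (c \<cdot>\<^sub>R Y) = c \<cdot>\<^sub>R vf_bracket X Y"
proof (intro ext)
  fix p f
  show "vf_bracket X (c \<cdot>\<^sub>R Y) p f = (c \<cdot>\<^sub>R vf_bracket X Y) p f"
    using assms
    by (cases "f \<in> C_infty M \<A>")
      (simp_all add: vf_scale_def vf_bracket_def vf_scale[OF assms(1)] vf_not_C_infty vf_zero vf_app_C_infty
        right_diff_distrib)
qed

text \<open>On smooth \<open>f\<close> both sides expand into triple compositions; on the right
  those with \<open>Z\<close> in the middle cancel. This form of the Jacobi identity matches the
  antisymmetrised iterated brackets in the curvature.\<close>

lemma vf_bracket_jacobi:
  assumes "X \<in> vector_fields M \<A>" "Y \<in> vector_fields M \<A>" "Z \<in> vector_fields M \<A>"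
  shows "vf_bracket (vf_bracket X Y) Z
    = vf_bracket X (vf_bracket Y Z) - vf_bracket Y (vf_bracket X Z)"
proof (intro ext)
  fix p f
  show "vf_bracket (vf_bracket X Y) Z p f
    = (vf_bracket X (vf_bracket Y Z) - vf_bracket Y (vf_bracket X Z)) p f"
    using assms
    by (cases "f \<in> C_infty M \<A>")
      (simp_all add: vf_bracket_def assms[THEN vf_diff] vf_not_C_infty vf_zero assms[THEN vf_app_C_infty])
qed

end

lemma (in F_manifold) prd_const_scale_right:
  assumes "X \<in> vector_fields M \<A>" "Y \<in> vector_fields M \<A>"
  shows "X \<circ>\<^sub>F (c \<cdot>\<^sub>R Y) = c \<cdot>\<^sub>R (X \<circ>\<^sub>F Y)"
proof -
  \<comment> \<open>Since \<open>Z\<close> vanishes off \<open>M\<close>, cutting off the constant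
    changes nothing, and bilinearity over smooth functions applies.\<close>
  have "c \<cdot>\<^sub>R Z = (\<lambda>x. if x \<in> M then c else 0) \<cdot>\<^sub>F Z" if "Z \<in> vector_fields M \<A>" for Z
    using that by (auto simp: vf_scale_def vf_fscale_def fun_eq_iff vf_outside)
  then show ?thesis
    using assms prd_scale_right[OF C_infty_const assms] prd_closed by simp
qed


section \<open>Left-invariant fields\<close>

context lie_group
begin

lemma left_invariant_fieldsD: "X \<in> left_invariant_fields G \<A> \<Longrightarrow> X \<in> vector_fields (carrier G) \<A>"
  by (simp add: left_invariant_fields_def)

text \<open>Left invariance read on functions: the field commutes with pulling back along left
  translation by \<open>a\<close>.\<close>

lemma left_invariant_apply:
  assumes "X \<in> left_invariant_fields G \<A>" "a \<in> carrier G" "x \<in> carrier G" "f \<in> C_infty (carrier G) \<A>"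
  shows "X (a \<otimes> x) f = X x (\<lambda>y. if y \<in> carrier G then f (a \<otimes> y) else 0)"
  using assms by (simp add: left_invariant_fields_def differential_def)

lemma left_invariant_fieldsI:
  assumes "X \<in> vector_fields (carrier G) \<A>"
    and "\<And>a x f. a \<in> carrier G \<Longrightarrow> x \<in> carrier G \<Longrightarrow> f \<in> C_infty (carrier G) \<A> \<Longrightarrow>
      X (a \<otimes> x) f = X x (\<lambda>y. if y \<in> carrier G then f (a \<otimes> y) else 0)"
  shows "X \<in> left_invariant_fields G \<A>"
  using assms vf_not_C_infty[OF assms(1)]
  by (auto simp: left_invariant_fields_def differential_def fun_eq_iff)

lemma left_invariant_add:
  assumes "X \<in> left_invariant_fields G \<A>" "Y \<in> left_invariant_fields G \<A>"
  shows "X + Y \<in> left_invariant_fields G \<A>"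
  by (intro left_invariant_fieldsI vector_fields_add assms[THEN left_invariant_fieldsD])
    (simp add: assms[THEN left_invariant_apply])

lemma left_invariant_scale:
  assumes "X \<in> left_invariant_fields G \<A>"
  shows "c \<cdot>\<^sub>R X \<in> left_invariant_fields G \<A>"
  by (intro left_invariant_fieldsI vector_fields_scale assms[THEN left_invariant_fieldsD])
    (simp add: vf_scale_def assms[THEN left_invariant_apply])

text \<open>Operators that commute with pullback along left translations have a commutator that does
  so too.\<close>

lemma left_invariant_bracket:
  assumes "X \<in> left_invariant_fields G \<A>" "Y \<in> left_invariant_fields G \<A>"
  shows "vf_bracket X Y \<in> left_invariant_fields G \<A>"
proof (intro left_invariant_fieldsI vector_fields_bracket assms[THEN left_invariant_fieldsD])
  fix a x f
  assume a: "a \<in> carrier G" and x: "x \<in> carrier G" and f: "f \<in> C_infty (carrier G) \<A>"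
  let ?f = "\<lambda>y. if y \<in> carrier G then f (a \<otimes> y) else 0"
  have *: "V (a \<otimes> x) (\<lambda>q. W q f) = V x (\<lambda>q. W q ?f)"
    if V: "V \<in> left_invariant_fields G \<A>" and W: "W \<in> left_invariant_fields G \<A>" for V W
  proof -
    \<comment> \<open>Invariance of \<open>W\<close> says that the pullback of \<open>W f\<close> is
      \<open>W\<close> of the pullback of \<open>f\<close>; off the group both are 0. Invariance of
      \<open>V\<close> at the smooth function \<open>W f\<close> then finishes.\<close>
    have "(\<lambda>q. if q \<in> carrier G then W (a \<otimes> q) f else 0) = (\<lambda>q. W q ?f)"
      using left_invariant_apply[OF W a _ f] vf_outside[OF left_invariant_fieldsD[OF W]]
      by (intro ext) simp
    then show ?thesis
      using left_invariant_apply[OF V a x vf_app_C_infty[OF left_invariant_fieldsD[OF W] f]] by simp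
  qed
  show "vf_bracket X Y (a \<otimes> x) f = vf_bracket X Y x ?f"
    by (simp only: vf_bracket_def *[OF assms] *[OF assms(2,1)])
qed

end

section \<open>The curvature computation\<close>

theorem theorem3p4:
  fixes G :: "('g::{t2_space, second_countable_topology}, 'm) monoid_scheme"
    and \<A> :: "('g, 'e::real_normed_vector) chart set"
    and prd nabla :: "'g vfield \<Rightarrow> 'g vfield \<Rightarrow> 'g vfield"
  assumes "F_lie_group G \<A> prd"
    and "left_invariant_connection G \<A> nabla"
    and "\<And>u v. \<lbrakk>u \<in> left_invariant_fields G \<A>; v \<in> left_invariant_fields G \<A>\<rbrakk> \<Longrightarrow>
      nabla u v = (1/2) \<cdot>\<^sub>R vf_bracket u v + prd u v"
    and "u \<in> left_invariant_fields G \<A>"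
    and "v \<in> left_invariant_fields G \<A>"
    and "w \<in> left_invariant_fields G \<A>"
  shows "curvature nabla u v w =
    (-1/4) \<cdot>\<^sub>R vf_bracket (vf_bracket u v) w
      + (1/2) \<cdot>\<^sub>R (leibnizator prd u v w - leibnizator prd v u w)"
proof -
  interpret F: F_lie_group G \<A> prd by fact
  note nabla = assms(3) and u = assms(4) and v = assms(5) and w = assms(6)
  \<comment> \<open>The formula for \<open>nabla\<close> is given on left-invariant fields only, so
    iterating it needs these closure properties.\<close>
  note linv = F.left_invariant_bracket F.left_invariant_add F.left_invariant_scale
    F.prd_left_invariant
  have nabla_nabla: "nabla x (nabla y w) = (1/4) \<cdot>\<^sub>R vf_bracket x (vf_bracket y w)
      + (1/2) \<cdot>\<^sub>R vf_bracket x (prd y w) + (1/2) \<cdot>\<^sub>R prd x (vf_bracket y w) + prd x (prd y w)"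
    if x: "x \<in> left_invariant_fields G \<A>" and y: "y \<in> left_invariant_fields G \<A>" for x y
  proof -
    have "nabla x (nabla y w) = (1/2) \<cdot>\<^sub>R vf_bracket x ((1/2) \<cdot>\<^sub>R vf_bracket y w + prd y w)
        + prd x ((1/2) \<cdot>\<^sub>R vf_bracket y w + prd y w)"
      by (simp only: nabla linv x y w)
    also have "\<dots> = (1/2) \<cdot>\<^sub>R ((1/2) \<cdot>\<^sub>R vf_bracket x (vf_bracket y w) + vf_bracket x (prd y w))
        + ((1/2) \<cdot>\<^sub>R prd x (vf_bracket y w) + prd x (prd y w))"
      by (simp only: F.vf_bracket_add_right F.vf_bracket_scale_right F.prd_add_right
          F.prd_const_scale_right F.left_invariant_fieldsD linv x y w)
    finally show ?thesis
      by (simp add: vf_scale_def fun_eq_iff algebra_simps)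
  qed
  have VF: "u \<in> vector_fields (carrier G) \<A>" "v \<in> vector_fields (carrier G) \<A>"
    "w \<in> vector_fields (carrier G) \<A>"
    using u v w F.left_invariant_fieldsD by auto
  \<comment> \<open>These are the terms quadratic in the product; they cancel in the
    curvature.\<close>
  have assoc: "prd u (prd v w) = prd v (prd u w)"
    using VF F.prd_assoc F.prd_comm by metis
  have "vf_bracket v u = (-1) \<cdot>\<^sub>R vf_bracket u v"
    by (simp add: F.vf_bracket_antisym[of v u] vf_scale_def fun_eq_iff)
  \<comment> \<open>Both Leibnizators thus involve \<open>prd (vf_bracket u v) w\<close>. Half of
    their difference contains it with coefficient -1, as does the curvature through
    \<open>nabla (vf_bracket u v) w\<close>.\<close>
  then have antisym: "prd (vf_bracket v u) w = (-1) \<cdot>\<^sub>R prd (vf_bracket u v) w"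
    using VF F.vector_fields_bracket F.prd_const_scale_right F.prd_comm F.vector_fields_scale
    by metis
  \<comment> \<open>The iterated brackets contribute 1/4 of
    \<open>vf_bracket (vf_bracket u v) w\<close>, and subtracting
    \<open>nabla (vf_bracket u v) w\<close> removes 1/2, which leaves -1/4.\<close>
  have jacobi: "vf_bracket u (vf_bracket v w)
      = vf_bracket (vf_bracket u v) w + vf_bracket v (vf_bracket u w)"
    using F.vf_bracket_jacobi[OF VF] by simp
  show ?thesis
    unfolding curvature_def leibnizator_def nabla_nabla[OF u v] nabla_nabla[OF v u]
      nabla[OF F.left_invariant_bracket[OF u v] w] antisym jacobi assoc
    by (simp add: vf_scale_def fun_eq_iff field_simps)
qed

end
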